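(* Let $\ell\ge1$ be an integer, let $\mathscr{R}=\{(a,b)\in\mathbb{Z}^2: 0\le a\le b\le \ell-1\}$ with the componentwise order, and let $\mathrm{wt}$ be a rank increasing and rank constant weight function on $\mathscr{R}$. If $A\subseteq\mathscr{R}$ is an optimal downset, then one of the following holds: (1) $A$ is the initial segment of size $|A|$ of $\mathcal{L}$ or of $\mathcal{C}$ (restricted to $\mathscr{R}$); (2) there exist $\mathcal{D}\in\{\mathcal{L},\mathcal{C}\}$, a packed poset $\mathscr{Q}\subseteq\mathscr{R}$ and coordinates $c_1,c_2\in\{1,2\}$ such that $A=\mathrm{Sym}(\mathscr{Q},I,c_1,c_2)$, where $I$ is the initial segment of size $|A|$ of $\mathcal{D}$ restricted to $\mathscr{R}$.
   Context: The rank of $(a,b)$ is $a+b$; $\mathrm{wt}$ is rank constant if equal ranks give equal weights and rank increasing if strictly smaller rank gives strictly smaller weight; $\mathrm{wt}(S)=\sum_{s\in S}\mathrm{wt}(s)$. A downset of $\mathscr{R}$ is a subset $A$ with: $x\le y$ componentwise, $x\in\mathscr{R}$, $y\in A$ imply $x\in A$; it is optimal if its weight is at least that of every downset of $\mathscr{R}$ of the same size. $\mathcal{L}$: $(a,b)<(c,d)$ iff $a<c$, or $a=c$ and $b<d$. $\mathcal{C}$: $(a,b)<(c,d)$ iff $b<d$, or $b=d$ and $a<c$. The initial segment of size $m$ is the set of the $m$ smallest elements of $\mathscr{R}$ in the order. A packed poset in $\mathscr{R}$ is a set $\mathscr{Q}=\{(a,b): s_1\le a\le t_1,\ s_2\le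 b\le t_2\}$ contained in $\mathscr{R}$. For $c_1=c_2$, $\mathrm{Sym}(\mathscr{Q},A,c_1,c_2)=A$; for $\{c_1,c_2\}=\{1,2\}$ with $t_1-s_1=t_2-s_2$, let $\rho(a,b)=(s_1+b-s_2,s_2+a-s_1)$ on $\mathscr{Q}$, local coordinates $u_1=a-s_1$, $u_2=b-s_2$ of $f=(a,b)$, $f_{(c_1,c_2)}=\rho(f)$ if $u_{c_1}<u_{c_2}$ and $=f$ otherwise, and $\mathrm{Sym}(\mathscr{Q},A,c_1,c_2)=(A\setminus\mathscr{Q})\cup\{f\in A\cap\mathscr{Q}:\rho(f)\in A\}\cup\{f_{(c_1,c_2)}:f\in A\cap\mathscr{Q}\}$. *)

theory Defs
  imports Complex_Main "HOL-Library.Product_Order"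
begin

text \<open>The order \<open>\<le>\<close> on \<^typ>\<open>int \<times> int\<close> is the componentwise order of \<^theory>\<open>HOL-Library.Product_Order\<close>.\<close>

definition triangle :: "int \<Rightarrow> (int \<times> int) set" where
  "triangle l = {(a, b). 0 \<le> a \<and> a \<le> b \<and> b \<le> l - 1}"

definition rank :: "int \<times> int \<Rightarrow> int" where
  "rank x = fst x + snd x"

definition rank_constant :: "(int \<times> int) set \<Rightarrow> (int \<times> int \<Rightarrow> real) \<Rightarrow> bool" where
  "rank_constant R wt \<longleftrightarrow> (\<forall>x\<in>R. \<forall>y\<in>R. rank x = rank y \<longrightarrow> wt x = wt y)"

definition rank_increasing :: "(int \<times> int) set \<Rightarrow> (int \<times> int \<Rightarrow> real) \<Rightarrow> bool" where
  "rank_increasing R wt \<longleftrightarrow> (\<forall>x\<in>R. \<forall>y\<in>R. rank x < rank y \<longrightarrow> wt x < wt y)"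

definition downset :: "(int \<times> int) set \<Rightarrow> (int \<times> int) set \<Rightarrow> bool" where
  "downset R A \<longleftrightarrow> A \<subseteq> R \<and> (\<forall>x\<in>R. \<forall>y\<in>A. x \<le> y \<longrightarrow> x \<in> A)"

definition optimal_downset ::
    "(int \<times> int) set \<Rightarrow> (int \<times> int \<Rightarrow> real) \<Rightarrow> (int \<times> int) set \<Rightarrow> bool" where
  "optimal_downset R wt A \<longleftrightarrow>
     downset R A \<and> (\<forall>B. downset R B \<and> card B = card A \<longrightarrow> sum wt B \<le> sum wt A)"

definition less_L :: "int \<times> int \<Rightarrow> int \<times> int \<Rightarrow> bool" where
  "less_L x y \<longleftrightarrow> fst x < fst y \<or> fst x = fst y \<and> snd x < snd y"

definition less_C :: "int \<times> int \<Rightarrow> int \<times> int \<Rightarrow> bool" where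
  "less_C x y \<longleftrightarrow> snd x < snd y \<or> snd x = snd y \<and> fst x < fst y"

text \<open>For finite \<open>R\<close> and a strict total order \<open>lt\<close>, an element is among the \<open>m\<close> smallest
  iff it has fewer than \<open>m\<close> predecessors in \<open>R\<close>.\<close>

definition initial_segment ::
    "(int \<times> int \<Rightarrow> int \<times> int \<Rightarrow> bool) \<Rightarrow> (int \<times> int) set \<Rightarrow> nat \<Rightarrow> (int \<times> int) set" where
  "initial_segment lt R m = {x \<in> R. card {y \<in> R. lt y x} < m}"

text \<open>A packed poset is represented by its corners \<open>s = (s1, s2)\<close> and \<open>t = (t1, t2)\<close>.\<close>

definition packed :: "int \<times> int \<Rightarrow> int \<times> int \<Rightarrow> (int \<times> int) set" where
  "packed s t = {(a, b). fst s \<le> a \<and> a \<le> fst t \<and> snd s \<le> b \<and> b \<le> snd t}"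

definition square :: "int \<times> int \<Rightarrow> int \<times> int \<Rightarrow> bool" where
  "square s t \<longleftrightarrow> fst t - fst s = snd t - snd s"

definition reflect :: "int \<times> int \<Rightarrow> int \<times> int \<Rightarrow> int \<times> int" where
  "reflect s f = (fst s + snd f - snd s, snd s + fst f - fst s)"

text \<open>Coordinates are the natural numbers 1 and 2.\<close>

definition local_coord :: "int \<times> int \<Rightarrow> nat \<Rightarrow> int \<times> int \<Rightarrow> int" where
  "local_coord s c f = (if c = 1 then fst f - fst s else snd f - snd s)"

definition orient :: "int \<times> int \<Rightarrow> nat \<Rightarrow> nat \<Rightarrow> int \<times> int \<Rightarrow> int \<times> int" where
  "orient s c1 c2 f = (if local_coord s c1 f < local_coord s c2 f then reflect s f else f)"

text \<open>Only meaningful if \<open>c1 = c2\<close> or \<open>square s t\<close>; users must impose this condition.\<close>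

definition Sym ::
    "int \<times> int \<Rightarrow> int \<times> int \<Rightarrow> (int \<times> int) set \<Rightarrow> nat \<Rightarrow> nat \<Rightarrow> (int \<times> int) set" where
  "Sym s t A c1 c2 =
     (if c1 = c2 then A
      else (A - packed s t)
         \<union> {f \<in> A \<inter> packed s t. reflect s f \<in> A}
         \<union> orient s c1 c2 ` (A \<inter> packed s t))"

end

theory Submission
  imports Defs
begin

text \<open>A downset of the triangle is encoded by a lattice path of \<open>l\<close> steps, whose steps up are the rows.
  Removable cells sit at the peaks and addable cells at the valleys, with ranks given by the heights, so
  that exchanging cells between a high valley and a low peak increases the weight. A final piece of the
  path of an optimal downset is optimal in a smaller triangle, and taking complements exchanges the
  steps up and down as well as the two orders. By induction on the length it therefore suffices to exclude
  a few paths with at most five runs by explicit exchanges. What remains are the initial segments and,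
  for each order, two families that arise from them by transposing a square.\<close>

section \<open>Words, their weights and telescoping sums\<close>

definition increment :: "(int \<Rightarrow> real) \<Rightarrow> int \<Rightarrow> real" where
  "increment P x = P (x + 1) - P x"

text \<open>A downset of the triangle is a word over \<open>{True, False}\<close> of length \<open>l\<close>: a letter \<open>True\<close>
  followed by \<open>n\<close> letters stands for a row of \<open>n + 1\<close> cells that starts on the diagonal. If the
  diagonal cell has rank \<open>k\<close>, the cells of that row have ranks \<open>k, \<dots>, k + n\<close>, so that its weight
  telescopes when \<open>increment P\<close> is the weight of a rank.\<close>

primrec word_weight :: "(int \<Rightarrow> real) \<Rightarrow> int \<Rightarrow> bool list \<Rightarrow> real" where
  "word_weight P k [] = 0"
| "word_weight P k (x # w) =
     (if x then P (k + int (length w) + 1) - P k + word_weight P (k + 2) w else word_weight P k w)"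

text \<open>Reading \<open>True\<close> as a step up and \<open>False\<close> as a step down, started at height \<open>k + l\<close>, the height
  in front of a step up is one more than the rank of the last cell of that row.\<close>

primrec height_sum :: "(int \<Rightarrow> real) \<Rightarrow> int \<Rightarrow> bool list \<Rightarrow> real" where
  "height_sum P h [] = 0"
| "height_sum P h (x # w) =
     (if x then P h + height_sum P (h + 1) w else height_sum P (h - 1) w)"

text \<open>Successive diagonal cells have ranks \<open>k\<close>, \<open>k + 2\<close>, and so on:
  these are the lower ends of the telescoped row weights, and they depend only on the number of
  rows.\<close>

primrec start_sum :: "(int \<Rightarrow> real) \<Rightarrow> int \<Rightarrow> nat \<Rightarrow> real" where
  "start_sum P k 0 = 0"
| "start_sum P k (Suc m) = start_sum P k m + P (k + 2 * int m)"

abbreviation ups :: "nat \<Rightarrow> bool list" where "ups n \<equiv> replicate n True"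
abbreviation downs :: "nat \<Rightarrow> bool list" where "downs n \<equiv> replicate n False"

lemma start_sum_Suc_left: "start_sum P k (Suc m) = P k + start_sum P (k + 2) m"
  by (induction m) (auto simp: algebra_simps)

lemma word_weight_eq_height_sum:
  "word_weight P k w = height_sum P (k + int (length w)) w - start_sum P k (count_list w True)"
proof (induction w arbitrary: k)
  case (Cons x w)
  show ?case
    using Cons.IH[of "k + 2"] Cons.IH[of k] start_sum_Suc_left[of P k "count_list w True"]
    by (auto simp: algebra_simps)
qed simp

lemma height_sum_append_downs [simp]:
  "height_sum P h (downs b @ w) = height_sum P (h - int b) w"
  by (induction b arbitrary: h) (auto simp: algebra_simps)

lemma height_sum_downs [simp]: "height_sum P h (downs b) = 0"
  using height_sum_append_downs[of P h b "[]"] by simp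

lemma height_sum_append_ups [simp]:
  "height_sum (increment Q) h (ups b @ w) =
     Q (h + int b) - Q h + height_sum (increment Q) (h + int b) w"
proof (induction b arbitrary: h)
  case (Suc b)
  show ?case using Suc[of "h + 1"] by (simp add: increment_def algebra_simps)
qed simp

lemma height_sum_ups [simp]:
  "height_sum (increment Q) h (ups b) = Q (h + int b) - Q h"
  using height_sum_append_ups[of Q h b "[]"] by simp

lemma count_list_replicate [simp]:
  "count_list (replicate n x) y = (if x = y then n else 0)"
  by (induction n) auto

lemma antiderivative_exists: "\<exists>Q. P = increment Q"
proof (intro exI ext)
  fix x :: int
  \<comment> \<open>A signed sum from 0 to \<open>x\<close>; one of the two sums is always
    empty.\<close>
  let ?Q = "\<lambda>x::int. sum P {0..<x} - sum P {x..<0}"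
  show "P x = increment ?Q x"
  proof (cases "x \<ge> 0")
    case True
    then have "{0..<x + 1} = insert x {0..<x}" by auto
    with True show ?thesis by (simp add: increment_def)
  next
    case False
    then have "{x..<0} = insert x {x + 1..<0}" by auto
    with False show ?thesis by (simp add: increment_def)
  qed
qed

section \<open>Convex potentials, optimal words and complements\<close>

definition strictly_convex :: "(int \<Rightarrow> real) \<Rightarrow> bool" where
  "strictly_convex P \<longleftrightarrow> strict_mono (increment P)"

text \<open>Under the potential \<open>of_int\<close> every cell weighs 1, so the competitors are
  the words of the same length with the same number of cells.\<close>

definition optimal_word :: "(int \<Rightarrow> real) \<Rightarrow> int \<Rightarrow> bool list \<Rightarrow> bool" where
  "optimal_word P k w \<longleftrightarrow>
     (\<forall>w'. length w' = length w \<and> word_weight of_int k w' = word_weight of_int k w \<longrightarrow> word_weight P k w' \<le> word_weight P k w)"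

text \<open>For \<open>increment Q = of_int\<close> the third hypothesis says that both words have the same number of
  cells.\<close>

lemma not_optimal_wordI:
  assumes cvx: "strictly_convex P"
    and len: "length w' = length w"
    and alg: "\<And>Q. word_weight (increment Q) k w' - word_weight (increment Q) k w =
      increment (increment Q) x - increment (increment Q) y"
    and less: "y < x"
  shows "\<not> optimal_word P k w"
proof
  \<comment> \<open>Any potential is an increment, so the identity holds for \<open>of_int\<close>,
    where the right side vanishes, and for \<open>P\<close>, where it is positive.\<close>
  have diff: "word_weight P k w' - word_weight P k w = increment P x - increment P y" for P
    using antiderivative_exists[of P] alg by metis
  assume "optimal_word P k w"
  moreover have "word_weight of_int k w' = word_weight of_int k w"
    using diff[of of_int] by (simp add: increment_def)
  ultimately have "word_weight P k w' \<le> word_weight P k w"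
    using len unfolding optimal_word_def by blast
  moreover have "increment P y < increment P x"
    using cvx less unfolding strictly_convex_def strict_mono_def by blast
  ultimately show False using diff[of P] by simp
qed

text \<open>A first row depends only on the length of the tail, so putting it back turns competitors
  of the tail into competitors of the word. The next diagonal cell has rank
  \<open>k + 2\<close>.\<close>

lemma optimal_word_tl:
  assumes "optimal_word P k (x # w)"
  shows "optimal_word P (if x then k + 2 else k) w"
  unfolding optimal_word_def
proof (intro allI impI)
  fix w' assume w': "length w' = length w \<and>
    word_weight of_int (if x then k + 2 else k) w' = word_weight of_int (if x then k + 2 else k) w"
  then have "length (x # w') = length (x # w) \<and> word_weight of_int k (x # w') = word_weight of_int k (x # w)"
    by auto
  then have "word_weight P k (x # w') \<le> word_weight P k (x # w)"
    using assms unfolding optimal_word_def by blast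
  with w' show "word_weight P (if x then k + 2 else k) w' \<le> word_weight P (if x then k + 2 else k) w"
    by (auto split: if_splits)
qed

text \<open>Enlarging a full triangle appends a last column, with ranks \<open>k + n\<close> to
  \<open>k + 2 * n\<close>.\<close>

lemma word_weight_ups_Suc:
  "word_weight P k (ups (Suc n)) =
     word_weight P k (ups n) + P (k + 2 * int n + 1) - P (k + int n)"
proof (induction n arbitrary: k)
  case (Suc n)
  show ?case using Suc.IH[of "k + 2"] by (simp add: algebra_simps)
qed simp

text \<open>Flipping all letters replaces a downset by its complement, turned around by
  \<open>(a, b) \<mapsto> (l - 1 - b, l - 1 - a)\<close>.\<close>

lemma word_weight_flip:
  "word_weight P k w = word_weight P k (ups (length w)) +
     word_weight (\<lambda>x. P (1 - x)) (2 - k - 2 * int (length w)) (map Not w)"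
proof (induction w arbitrary: k)
  case (Cons x w)
  from word_weight_ups_Suc[of P k "length w"] Cons.IH[of "k + 2"] Cons.IH[of k]
  show ?case by (auto simp: algebra_simps)
qed simp

lemma word_weight_reflect_of_int: "word_weight (\<lambda>x. 1 - of_int x) k w = - word_weight of_int k w"
  by (induction w arbitrary: k) auto

text \<open>The reflected potential gives rank \<open>x\<close> the weight
  \<open>- increment P (- x)\<close>; the two sign changes preserve monotonicity.\<close>

lemma strictly_convex_flip:
  assumes "strictly_convex P" shows "strictly_convex (\<lambda>x. P (1 - x))"
  unfolding strictly_convex_def strict_mono_def
proof (intro allI impI)
  fix x y :: int assume "x < y"
  then have "increment P (- y) < increment P (- x)"
    using assms unfolding strictly_convex_def strict_mono_def by simp
  then show "increment (\<lambda>x. P (1 - x)) x < increment (\<lambda>x. P (1 - x)) y"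
    by (simp add: increment_def)
qed

text \<open>For fixed length, the weight of a word and the reflected weight of its complement differ
  by a constant, so maxima correspond.\<close>

lemma optimal_word_flip:
  assumes "optimal_word P k w"
  shows "optimal_word (\<lambda>x. P (1 - x)) (2 - k - 2 * int (length w)) (map Not w)"
  unfolding optimal_word_def
proof (intro allI impI)
  fix w' assume w': "length w' = length (map Not w) \<and>
    word_weight of_int (2 - k - 2 * int (length w)) w' = word_weight of_int (2 - k - 2 * int (length w)) (map Not w)"
  have mm: "map Not (map Not w') = w'" by (simp add: comp_def)
  have "word_weight of_int k (map Not w') = word_weight of_int k w"
    using w' word_weight_flip[of of_int k "map Not w'"] word_weight_flip[of of_int k w] mm
    by (simp add: word_weight_reflect_of_int)
  then have "word_weight P k (map Not w') \<le> word_weight P k w"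
    using assms w' unfolding optimal_word_def by simp
  then show "word_weight (\<lambda>x. P (1 - x)) (2 - k - 2 * int (length w)) w'
      \<le> word_weight (\<lambda>x. P (1 - x)) (2 - k - 2 * int (length w)) (map Not w)"
    using w' word_weight_flip[of P k "map Not w'"] word_weight_flip[of P k w] mm by simp
qed

subsection \<open>Words that are not optimal\<close>

text \<open>Each competitor moves a strip of cells so that the ranks lost and gained cancel up to a single
  pair; second antiderivatives \<open>Q\<close> turn the weight of a run of equal letters into two terms.\<close>

lemma not_optimal_down_up_down1_up:
  assumes "strictly_convex P"
  shows "\<not> optimal_word P k (downs (a + b + c + 1) @ ups (Suc b) @ False # ups (Suc c))"
proof (rule not_optimal_wordI[OF assms])
  fix Q
  show "word_weight (increment Q) k (downs a @ True # downs (b + c + 2) @ ups b @ False # ups c) -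
      word_weight (increment Q) k (downs (a + b + c + 1) @ ups (Suc b) @ False # ups (Suc c)) =
    increment (increment Q) (k + 2 * int b + 2 * int c + 3) -
      increment (increment Q) (k + 2 * int b + int c + 2)"
    by (simp add: word_weight_eq_height_sum increment_def algebra_simps del: replicate_Suc)
qed auto

text \<open>The last \<open>i + 1\<close> cells of the first row move to the ends of the first
  \<open>i + 1\<close> rows behind the lone \<open>False\<close>. Both strips have consecutive
  ranks, the new one starting one higher.\<close>

lemma not_optimal_up_down_up_down1_up_ge:
  assumes "strictly_convex P"
  shows "\<not> optimal_word P k (True # downs (b + i + 1) @ ups (Suc b) @ False # ups (i + d + 1))"
proof (rule not_optimal_wordI[OF assms])
  fix Q
  show "word_weight (increment Q) k (downs (i + 1) @ True # downs b @ ups (b + i + 2) @ False # ups d) -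
      word_weight (increment Q) k (True # downs (b + i + 1) @ ups (Suc b) @ False # ups (i + d + 1)) =
    increment (increment Q) (k + 1 + int (b + i + 1) + int (Suc b) + 1 + int (i + d + 1)) -
      increment (increment Q) (k + 1 + int (b + i + 1) + int (Suc b) + 1 + int (i + d + 1) - int i - 1)"
    by (simp add: word_weight_eq_height_sum increment_def algebra_simps del: replicate_Suc)
qed auto

text \<open>One cell suffices: the end of the first row moves to the end of the first row behind the
  lone \<open>False\<close>, where its rank is higher.\<close>

lemma not_optimal_up_down_up_down1_up_less:
  assumes "strictly_convex P"
  shows "\<not> optimal_word P k (True # downs (a + 1) @ ups (Suc (Suc (a + i))) @ False # ups (Suc c))"
proof (rule not_optimal_wordI[OF assms])
  fix Q
  show "word_weight (increment Q) k (False # True # downs a @ ups (Suc (Suc (Suc (a + i)))) @ False # ups c) -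
      word_weight (increment Q) k (True # downs (a + 1) @ ups (Suc (Suc (a + i))) @ False # ups (Suc c)) =
    increment (increment Q) (k + 1 + int (a + 1) + int (Suc (Suc (a + i))) + 1 + int (Suc c) + int i + 1) -
      increment (increment Q) (k + 1 + int (a + 1) + int (Suc (Suc (a + i))) + 1 + int (Suc c) - 1)"
    by (simp add: word_weight_eq_height_sum increment_def algebra_simps del: replicate_Suc)
qed auto

text \<open>The later rows give their last cells to the first row at unchanged ranks, except that
  the last row, of two cells, moves entirely and each of its cells gains one rank.\<close>

lemma not_optimal_down_up_down1:
  assumes "strictly_convex P"
  shows "\<not> optimal_word P k (downs (b + i + 2) @ ups (b + 2) @ [False])"
proof (rule not_optimal_wordI[OF assms])
  fix Q
  show "word_weight (increment Q) k (downs i @ True # downs (b + 3) @ ups b @ [False]) -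
      word_weight (increment Q) k (downs (b + i + 2) @ ups (b + 2) @ [False]) =
    increment (increment Q) (k + int (b + i + 2) + int (b + 2) + 1 - int i - 1) -
      increment (increment Q) (k + int (b + i + 2) + int (b + 2) + 1 - int i - 3)"
    by (simp add: word_weight_eq_height_sum increment_def algebra_simps del: replicate_Suc)
qed auto

text \<open>The end of the first row becomes the diagonal cell of a new last row.\<close>

lemma not_optimal_up_down_up_down1_le:
  assumes "strictly_convex P"
  shows "\<not> optimal_word P k (True # downs (a + 1) @ ups (a + i + 1) @ [False])"
proof (rule not_optimal_wordI[OF assms])
  fix Q
  show "word_weight (increment Q) k (False # True # downs a @ ups (a + i + 2)) -
      word_weight (increment Q) k (True # downs (a + 1) @ ups (a + i + 1) @ [False]) =
    increment (increment Q) (k + 1 + int (a + 1) + int (a + i + 1) + 1 + int i) -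
      increment (increment Q) (k + 1 + int (a + 1) + int (a + i + 1) + 1 - 1)"
    by (simp add: word_weight_eq_height_sum increment_def algebra_simps del: replicate_Suc)
qed auto

text \<open>The last \<open>i + 1\<close> rows give their last cells to the first row, each cell
  gaining one rank.\<close>

lemma not_optimal_down_up1_down_up_le:
  assumes "strictly_convex P"
  shows "\<not> optimal_word P k (downs (i + d + 1) @ True # downs (b + 1) @ ups (b + i + 1))"
proof (rule not_optimal_wordI[OF assms])
  fix Q
  show "word_weight (increment Q) k (downs d @ True # downs (b + i + 2) @ ups b @ False # ups i) -
      word_weight (increment Q) k (downs (i + d + 1) @ True # downs (b + 1) @ ups (b + i + 1)) =
    increment (increment Q) (k + int (i + d + 1) + 1 + int (b + 1) + int (b + i + 1) - int d - 1) -
      increment (increment Q) (k + int (i + d + 1) + 1 + int (b + 1) + int (b + i + 1) - int i - int d - 2)"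
    by (simp add: word_weight_eq_height_sum increment_def algebra_simps del: replicate_Suc)
qed auto

text \<open>The single cell of the last row moves to the end of the first row, which has higher rank
  because the downward run before the final run is longer than it.\<close>

lemma not_optimal_down_up1_down_up_gt:
  assumes "strictly_convex P"
  shows "\<not> optimal_word P k (downs (a + 1) @ True # downs (c + i + 2) @ ups (c + 1))"
proof (rule not_optimal_wordI[OF assms])
  fix Q
  show "word_weight (increment Q) k (downs a @ True # downs (c + i + 3) @ ups c @ [False]) -
      word_weight (increment Q) k (downs (a + 1) @ True # downs (c + i + 2) @ ups (c + 1)) =
    increment (increment Q) (k + int (a + 1) + 1 + int (c + i + 2) + int (c + 1) - int a - 1) -
      increment (increment Q) (k + int (a + 1) + 1 + int (c + i + 2) + int (c + 1) - int a - int i - 3)"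
    by (simp add: word_weight_eq_height_sum increment_def algebra_simps del: replicate_Suc)
qed auto

text \<open>The first row gives up \<open>a + 1\<close> cells and the second \<open>b\<close>;
  together they prolong the first \<open>a + b + 1\<close> rows of the final run. Ranks from the
  second row are kept, those from the first rise by one.\<close>

lemma not_optimal_up_down_up1_down_up_long:
  assumes "strictly_convex P"
  shows "\<not> optimal_word P k (True # downs (a + 1) @ True # downs (b + 1) @ ups (a + b + d + 1))"
proof (rule not_optimal_wordI[OF assms])
  fix Q
  show "word_weight (increment Q) k (downs (a + 1) @ True # downs b @ ups (a + b + 2) @ False # ups d) -
      word_weight (increment Q) k (True # downs (a + 1) @ True # downs (b + 1) @ ups (a + b + d + 1)) =
    increment (increment Q) (k + 1 + int (a + 1) + 1 + int (b + 1) + int (a + b + d + 1)) -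
      increment (increment Q) (k + 1 + int (a + 1) + 1 + int (b + 1) + int (a + b + d + 1) - int a - 1)"
    by (simp add: word_weight_eq_height_sum increment_def algebra_simps del: replicate_Suc)
qed auto

text \<open>The last cells of the last \<open>c + 3\<close> rows become a row of
  \<open>c + 2\<close> cells and one diagonal cell. The new row keeps all ranks but the lowest,
  which the diagonal cell raises by 3.\<close>

lemma not_optimal_up_down:
  assumes "strictly_convex P"
  shows "\<not> optimal_word P k (ups (Suc (Suc (Suc (c + i)))) @ downs (c + 3))"
proof (rule not_optimal_wordI[OF assms])
  fix Q
  show "word_weight (increment Q) k (ups i @ False # ups (Suc (Suc (Suc (Suc c)))) @ downs c @ [True]) -
      word_weight (increment Q) k (ups (Suc (Suc (Suc (c + i)))) @ downs (c + 3)) =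
    increment (increment Q) (k + int (c + i + 3) + int (c + 3) + int i + 2) -
      increment (increment Q) (k + int (c + i + 3) + int (c + 3) + int i - 1)"
    by (simp add: word_weight_eq_height_sum increment_def algebra_simps del: replicate_Suc)
qed auto

text \<open>One cell of the first row and \<open>b + 1\<close> of the second prolong
  \<open>b + 2\<close> rows of the final run. Ranks from the second row are kept, the other one
  rises by 2.\<close>

lemma not_optimal_up2_down_up_aux:
  assumes "strictly_convex P"
  shows "\<not> optimal_word P k (ups (Suc (Suc 0)) @ downs (b + 2) @ ups (Suc (Suc (b + d))))"
proof (rule not_optimal_wordI[OF assms])
  fix Q
  show "word_weight (increment Q) k (False # True # downs b @ ups (Suc (Suc (Suc b))) @ False # ups d) -
      word_weight (increment Q) k (ups (Suc (Suc 0)) @ downs (b + 2) @ ups (Suc (Suc (b + d)))) =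
    increment (increment Q) (k + 2 + int (b + 2) + int (b + d + 2) + 1) -
      increment (increment Q) (k + 2 + int (b + 2) + int (b + d + 2) - 1)"
    by (simp add: word_weight_eq_height_sum increment_def algebra_simps del: replicate_Suc)
qed auto

section \<open>Excluded words for arbitrary run lengths\<close>

lemma optimal_word_exchange:
  assumes opt: "optimal_word P k w"
    and len: "length w' = length w"
    and alg: "\<And>Q. word_weight (increment Q) k w' = word_weight (increment Q) k w"
  shows "optimal_word P k w'"
proof -
  have "word_weight P k w' = word_weight P k w" for P
    using antiderivative_exists[of P] alg by metis
  with opt len show ?thesis unfolding optimal_word_def by simp
qed

lemma not_optimal_up_down_up_down1_up:
  assumes "strictly_convex P" "a \<ge> 1" "b \<ge> 1" "c \<ge> 1"
  shows "\<not> optimal_word P k (True # downs a @ ups b @ False # ups c)"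
proof -
  \<comment> \<open>The three exchanges cover all run lengths; the first of them takes place in the
    tail.\<close>
  consider "a \<ge> b + c - 1" | "b \<le> a" "a \<le> b + c - 1" | "a < b" by linarith
  then show ?thesis
  proof cases
    case 1
    define b' c' a' where "b' = b - 1" and "c' = c - 1" and "a' = a - (b + c - 1)"
    then have "a = a' + b' + c' + 1" "b = Suc b'" "c = Suc c'" using 1 assms by auto
    with not_optimal_down_up_down1_up[OF assms(1), of "k + 2" a' b' c'] optimal_word_tl[of P k True] show ?thesis by fastforce
  next
    case 2
    define b' i d where "b' = b - 1" and "i = a - b" and "d = c - 1 - i"
    then have "a = b' + i + 1" "b = Suc b'" "c = i + d + 1" using 2 assms by auto
    with not_optimal_up_down_up_down1_up_ge[OF assms(1), of k b' i d] show ?thesis by simp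
  next
    case 3
    define a' i c' where "a' = a - 1" and "i = b - a - 1" and "c' = c - 1"
    then have "a = a' + 1" "b = Suc (Suc (a' + i))" "c = Suc c'" using 3 assms by auto
    with not_optimal_up_down_up_down1_up_less[OF assms(1), of k a' i c'] show ?thesis by simp
  qed
qed

lemma not_optimal_up_down_up_down1:
  assumes "strictly_convex P" "a \<ge> 1" "b \<ge> 2"
  shows "\<not> optimal_word P k (True # downs a @ ups b @ [False])"
proof (cases "b \<le> a")
  case True
  define b' i where "b' = b - 2" and "i = a - b"
  then have "a = b' + i + 2" "b = b' + 2" using True assms by auto
  with not_optimal_down_up_down1[OF assms(1), of "k + 2" b' i] optimal_word_tl[of P k True] show ?thesis by fastforce
next
  case False
  define a' i where "a' = a - 1" and "i = b - a"
  then have "a = a' + 1" "b = a' + i + 1" using False assms by auto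
  with not_optimal_up_down_up_down1_le[OF assms(1), of k a' i] show ?thesis by simp
qed

text \<open>Replacing the ending \<open>True, False, False\<close> by
  \<open>False, True, True\<close> moves one cell within its rank, so optimality would pass to a
  word already excluded.\<close>

lemma not_optimal_up_down_up_down2:
  assumes "strictly_convex P" "a \<ge> 1" "b \<ge> 2"
  shows "\<not> optimal_word P k (True # downs a @ ups b @ [False, False])"
proof
  assume "optimal_word P k (True # downs a @ ups b @ [False, False])"
  moreover obtain b' where b: "b = Suc b'" using assms(3) by (cases b) auto
  moreover have "word_weight (increment Q) k (True # downs a @ ups b' @ False # ups 2) =
     word_weight (increment Q) k (True # downs a @ ups (Suc b') @ [False, False])" for Q
    by (simp add: word_weight_eq_height_sum increment_def algebra_simps numeral_2_eq_2 del: replicate_Suc)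
  ultimately have "optimal_word P k (True # downs a @ ups b' @ False # ups 2)"
    using optimal_word_exchange[of P k "True # downs a @ ups b @ [False, False]"
        "True # downs a @ ups b' @ False # ups 2"] by simp
  with not_optimal_up_down_up_down1_up[OF assms(1), of a b' 2 k] b assms show False by simp
qed

lemma not_optimal_up_down_up1_down_up:
  assumes "strictly_convex P" "a \<ge> 1" "b \<ge> 1" "c \<ge> 1"
  shows "\<not> optimal_word P k (True # downs a @ True # downs b @ ups c)"
proof -
  consider "b \<le> c" "c < a + b" | "c < b" | "a + b \<le> c" by linarith
  then show ?thesis
  proof cases
    case 1
    define b' i d where "b' = b - 1" and "i = c - b" and "d = a - 1 - i"
    then have "a = i + d + 1" "b = b' + 1" "c = b' + i + 1" using 1 assms by auto
    with not_optimal_down_up1_down_up_le[OF assms(1), of "k + 2" i d b'] optimal_word_tl[of P k True] show ?thesis by fastforce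
  next
    case 2
    define a' i c' where "a' = a - 1" and "i = b - c - 1" and "c' = c - 1"
    then have "a = a' + 1" "b = c' + i + 2" "c = c' + 1" using 2 assms by auto
    with not_optimal_down_up1_down_up_gt[OF assms(1), of "k + 2" a' c' i] optimal_word_tl[of P k True] show ?thesis by fastforce
  next
    case 3
    define a' b' d where "a' = a - 1" and "b' = b - 1" and "d = c - a - b + 1"
    then have "a = a' + 1" "b = b' + 1" "c = a' + b' + d + 1" using 3 assms by auto
    with not_optimal_up_down_up1_down_up_long[OF assms(1), of k a' b' d] show ?thesis by simp
  qed
qed

lemma not_optimal_down_up:
  assumes "strictly_convex P" "n \<ge> 3" "n \<le> a"
  shows "\<not> optimal_word P k (downs a @ ups n)"
proof
  assume "optimal_word P k (downs a @ ups n)"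
  from optimal_word_flip[OF this]
  have "optimal_word (\<lambda>x. P (1 - x)) (2 - k - 2 * int (a + n)) (ups a @ downs n)" by simp
  moreover define c i where "c = n - 3" and "i = a - n"
  then have "n = c + 3" "a = Suc (Suc (Suc (c + i)))" using assms by auto
  ultimately show False using not_optimal_up_down[OF strictly_convex_flip[OF assms(1)]] by simp
qed

lemma not_optimal_up2_down_up:
  assumes "strictly_convex P" "b \<ge> 2" "b \<le> c"
  shows "\<not> optimal_word P k (True # True # downs b @ ups c)"
proof -
  define b' d where "b' = b - 2" and "d = c - b"
  then have "b = b' + 2" "c = Suc (Suc (b' + d))" using assms by auto
  with not_optimal_up2_down_up_aux[OF assms(1), of k b' d] show ?thesis by simp
qed

subsection \<open>Classification of optimal words\<close>

text \<open>The shapes are \<open>a\<close> full rows followed by: at most one partial row, which is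
  a segment of \<open>less_L\<close>; a triangle of three cells; or \<open>b\<close> rows lacking
  only their last cell. The last two arise by transposing a square.\<close>

definition L_family :: "bool list \<Rightarrow> bool" where
  "L_family w \<longleftrightarrow>
     (\<exists>a b c e. e \<le> 1 \<and> w = ups a @ downs b @ ups e @ downs c) \<or>
     (\<exists>a b. 1 \<le> b \<and> w = ups a @ downs b @ [True, True]) \<or>
     (\<exists>a b c. 1 \<le> b \<and> b < c \<and> w = ups a @ False # ups b @ downs c)"

definition C_family :: "bool list \<Rightarrow> bool" where
  "C_family w \<longleftrightarrow> L_family (map Not w)"

lemma L_family_Cons_True: "L_family w \<Longrightarrow> L_family (True # w)"
  unfolding L_family_def by (metis append_Cons replicate_Suc)

lemma C_family_cases:
  assumes "C_family w"
  obtains (segment) a b c e where "e \<le> 1" "w = downs a @ ups b @ downs e @ ups c"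
    | (corner) a b where "1 \<le> b" "w = downs a @ ups b @ [False, False]"
    | (square) a b c where "1 \<le> b" "b < c" "w = downs a @ True # downs b @ ups c"
proof -
  have w: "w = map Not (map Not w)" by (simp add: comp_def)
  from assms consider a b c e where "e \<le> 1" "map Not w = ups a @ downs b @ ups e @ downs c"
    | a b where "1 \<le> b" "map Not w = ups a @ downs b @ [True, True]"
    | a b c where "1 \<le> b" "b < c" "map Not w = ups a @ False # ups b @ downs c"
    unfolding C_family_def L_family_def by blast
  then show ?thesis
  proof cases
    case 1
    then have "w = map Not (ups a @ downs b @ ups e @ downs c)" using w by simp
    with 1(1) segment show ?thesis by simp
  next
    case 2
    then have "w = map Not (ups a @ downs b @ [True, True])" using w by simp
    with 2(1) corner show ?thesis by simp
  next
    case 3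
    then have "w = map Not (ups a @ False # ups b @ downs c)" using w by simp
    with 3(1,2) square show ?thesis by simp
  qed
qed

lemma L_familyI:
  "e \<le> 1 \<Longrightarrow> L_family (ups a @ downs b @ ups e @ downs c)"
  "1 \<le> b \<Longrightarrow> L_family (ups a @ downs b @ [True, True])"
  "1 \<le> b \<Longrightarrow> b < c \<Longrightarrow> L_family (ups a @ False # ups b @ downs c)"
  unfolding L_family_def by blast+

lemma C_familyI:
  "e \<le> 1 \<Longrightarrow> C_family (downs a @ ups b @ downs e @ ups c)"
  "1 \<le> b \<Longrightarrow> b < c \<Longrightarrow> C_family (downs a @ True # downs b @ ups c)"
  using L_familyI by (simp_all add: C_family_def)

lemma optimal_up_downs_ups:
  assumes cvx: "strictly_convex P" and opt: "optimal_word P k (True # downs a @ ups n)"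
  shows "L_family (True # downs a @ ups n) \<or> C_family (True # downs a @ ups n)"
proof -
  have tl: "optimal_word P (k + 2) (downs a @ ups n)" using optimal_word_tl[OF opt] by simp
  \<comment> \<open>A short final run gives a \<open>less_L\<close> shape, \<open>a <= 1\<close> a
    segment of \<open>less_C\<close>, and \<open>2 <= a < n\<close> its square shape; for
    \<open>3 <= n <= a\<close> the tail is not optimal.\<close>
  consider "n \<le> 1" | "n = 2" "a = 0" | "n = 2" "a \<ge> 1" | "n \<ge> 3" "a \<le> 1" | "n \<ge> 3" "2 \<le> a" "a < n" | "n \<ge> 3" "n \<le> a"
    by linarith
  then show ?thesis
  proof cases
    case 1
    then show ?thesis using L_familyI(1)[of n 1 a 0] by simp
  next
    case 2
    then show ?thesis using L_familyI(1)[of 0 3 0 0] by (simp add: eval_nat_numeral)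
  next
    case 3
    then show ?thesis using L_familyI(2)[of a 1] by (simp add: eval_nat_numeral)
  next
    case 4
    then show ?thesis using C_familyI(1)[of a 0 1 n] by simp
  next
    case 5
    then show ?thesis using C_familyI(2)[of a n 0] by simp
  next
    case 6
    then show ?thesis using not_optimal_down_up[OF cvx] tl by blast
  qed
qed

text \<open>A full first row preserves \<open>less_L\<close> shapes. A tail of \<open>less_C\<close>
  shape either merges with it into a listed shape or yields an excluded word.\<close>

lemma optimal_word_Cons_True:
  assumes cvx: "strictly_convex P" and opt: "optimal_word P k (True # w)"
    and fam: "L_family w \<or> C_family w"
  shows "L_family (True # w) \<or> C_family (True # w)"
  using fam
proof
  assume "L_family w"
  then show ?thesis using L_family_Cons_True by blast
next
  assume "C_family w"
  then show ?thesis
  proof (cases rule: C_family_cases)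
    case (segment a b c e)
    consider "a = 0" | "e = 0" | "e = 1" "b = 0" | "e = 1" "a \<ge> 1" "b = 1" "c = 0" | "e = 1" "a \<ge> 1" "b \<ge> 1" "c \<ge> 1"
      | "e = 1" "a \<ge> 1" "b \<ge> 2" "c = 0"
      using segment(1) by linarith
    then show ?thesis
    proof cases
      case 1
      then show ?thesis using segment C_familyI(1)[of e 0 "Suc b" c] by simp
    next
      case 2
      then show ?thesis using segment opt optimal_up_downs_ups[OF cvx, of k a "b + c"]
        by (simp add: replicate_add)
    next
      case 3
      then show ?thesis using segment opt optimal_up_downs_ups[OF cvx, of k "Suc a" c]
        by (simp add: replicate_app_Cons_same)
    next
      case 4
      then show ?thesis using segment L_familyI(1)[of 1 1 a 1] by simp
    next
      case 5
      then show ?thesis using segment opt not_optimal_up_down_up_down1_up[OF cvx, of a b c k] by simp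
    next
      case 6
      then show ?thesis using segment opt not_optimal_up_down_up_down1[OF cvx, of a b k] by simp
    qed
  next
    case (corner a b)
    consider "a = 0" | "a \<ge> 1" "b = 1" | "a \<ge> 1" "b \<ge> 2" using corner(1) by linarith
    then show ?thesis
    proof cases
      case 1
      then show ?thesis using corner L_familyI(1)[of 0 "Suc b" 2 0] by (simp add: eval_nat_numeral)
    next
      case 2
      then show ?thesis using corner L_familyI(1)[of 1 1 a 2] by (simp add: eval_nat_numeral)
    next
      case 3
      then show ?thesis using corner opt not_optimal_up_down_up_down2[OF cvx, of a b k] by simp
    qed
  next
    case (square a b c)
    consider "a = 0" "b = 1" | "a = 0" "b \<ge> 2" | "a \<ge> 1" using square(1) by linarith
    then show ?thesis
    proof cases
      case 1
      then show ?thesis using square C_familyI(1)[of 1 0 2 c] by (simp add: eval_nat_numeral)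
    next
      case 2
      then show ?thesis using square opt not_optimal_up2_down_up[OF cvx, of b c k] by simp
    next
      case 3
      then show ?thesis using square opt not_optimal_up_down_up1_down_up[OF cvx, of a b c k] by simp
    qed
  qed
qed

theorem optimal_word_classification:
  "strictly_convex P \<Longrightarrow> optimal_word P k w \<Longrightarrow> L_family w \<or> C_family w"
proof (induction w arbitrary: P k)
  case Nil
  then show ?case using L_familyI(1)[of 0 0 0 0] by simp
next
  case (Cons x w)
  note tl = Cons.IH[OF Cons.prems(1) optimal_word_tl[OF Cons.prems(2)]]
  show ?case
  proof (cases x)
    case True
    with tl Cons.prems show ?thesis using optimal_word_Cons_True by simp
  next
    case False
    have flip: "L_family (map Not v) \<or> C_family (map Not v) \<longleftrightarrow> L_family v \<or> C_family v" for v
      unfolding C_family_def by (auto simp: comp_def)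
    \<comment> \<open>Complementing makes the first letter \<open>True\<close> and exchanges the two
      families.\<close>
    have "optimal_word (\<lambda>x. P (1 - x)) (2 - k - 2 * int (length (x # w))) (True # map Not w)"
      using optimal_word_flip[OF Cons.prems(2)] False by simp
    from optimal_word_Cons_True[OF strictly_convex_flip[OF Cons.prems(1)] this] tl flip[of w]
    show ?thesis using flip[of "x # w"] False by simp
  qed
qed

subsection \<open>Downsets as words\<close>

text \<open>Each letter strips a line off a triangle: \<open>True\<close> a full first row,
  \<open>False\<close> an empty last column.\<close>

primrec cells :: "int \<Rightarrow> bool list \<Rightarrow> (int \<times> int) set" where
  "cells a [] = {}"
| "cells a (x # w) =
     (if x then Pair a ` {a..a + int (length w)} \<union> cells (a + 1) w else cells a w)"

definition shifted_triangle :: "int \<Rightarrow> nat \<Rightarrow> (int \<times> int) set" where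
  "shifted_triangle a n = {(x, y). a \<le> x \<and> x \<le> y \<and> y < a + int n}"

lemma triangle_eq_shifted: "l \<ge> 0 \<Longrightarrow> triangle l = shifted_triangle 0 (nat l)"
  by (auto simp: triangle_def shifted_triangle_def)

lemma cells_subset: "cells a w \<subseteq> shifted_triangle a (length w)"
proof (induction w arbitrary: a)
  case (Cons x w)
  have "shifted_triangle a (length w) \<subseteq> shifted_triangle a (length (x # w))"
    "shifted_triangle (a + 1) (length w) \<subseteq> shifted_triangle a (length (x # w))"
    "Pair a ` {a..a + int (length w)} \<subseteq> shifted_triangle a (length (x # w))"
    by (auto simp: shifted_triangle_def)
  then show ?case using Cons.IH[of a] Cons.IH[of "a + 1"] by (cases x) auto
qed simp

lemma finite_cells [simp]: "finite (cells a w)"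
  by (induction w arbitrary: a) auto

lemma cells_downs [simp]: "cells a (downs b @ w) = cells a w"
  by (induction b) auto

lemma cells_all_downs [simp]: "cells a (downs b) = {}"
  using cells_downs[of a b "[]"] by simp

lemma cells_ups:
  "cells a (ups b @ w) =
     {(x, y). a \<le> x \<and> x < a + int b \<and> x \<le> y \<and> y < a + int b + int (length w)}
     \<union> cells (a + int b) w"
proof (induction b arbitrary: a)
  case (Suc b)
  have "{(x, y). a \<le> x \<and> x < a + int (Suc b) \<and> x \<le> y \<and> y < a + int (Suc b) + int (length w)} =
      Pair a ` {a..a + int b + int (length w)} \<union>
      {(x, y). a + 1 \<le> x \<and> x < a + 1 + int b \<and> x \<le> y \<and> y < a + 1 + int b + int (length w)}"
    by (auto simp: image_iff)
  with Suc.IH[of "a + 1"] show ?case by (simp add: Un_assoc algebra_simps)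
qed auto

lemma cells_all_ups:
  "cells a (ups b) = {(x, y). a \<le> x \<and> x < a + int b \<and> x \<le> y \<and> y < a + int b}"
  using cells_ups[of a b "[]"] by simp

lemma sum_increment: "sum (\<lambda>y. increment P (a + y)) {a..<a + int n} = P (2 * a + int n) - P (2 * a)"
proof (induction n)
  case (Suc n)
  have "{a..<a + int (Suc n)} = insert (a + int n) {a..<a + int n}" by auto
  with Suc show ?case by (simp add: increment_def algebra_simps)
qed simp

text \<open>Ranks along a row are consecutive, so its weight telescopes. The start
  \<open>2 * a\<close> is the rank of the diagonal cell, and \<open>f = 1\<close> counts
  cells.\<close>

lemma sum_cells:
  "(\<And>x y. (x, y) \<in> cells a w \<Longrightarrow> f (x, y) = increment P (x + y)) \<Longrightarrow>
     sum f (cells a w) = word_weight P (2 * a) w"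
proof (induction w arbitrary: a)
  case (Cons x w)
  show ?case
  proof (cases x)
    case True
    let ?row = "Pair a ` {a..a + int (length w)}"
    have disj: "?row \<inter> cells (a + 1) w = {}"
      using cells_subset[of "a + 1" w] by (auto simp: shifted_triangle_def)
    have "sum f ?row = (\<Sum>y\<in>{a..<a + int (Suc (length w))}. f (a, y))"
      by (subst sum.reindex) (auto simp: inj_on_def intro!: sum.cong)
    also have "\<dots> = (\<Sum>y\<in>{a..<a + int (Suc (length w))}. increment P (a + y))"
      using Cons.prems True by (intro sum.cong) auto
    also have "\<dots> = P (2 * a + int (length w) + 1) - P (2 * a)"
      using sum_increment[of P a "Suc (length w)"] by (simp add: algebra_simps)
    finally have "sum f ?row = P (2 * a + int (length w) + 1) - P (2 * a)" .
    moreover have "sum f (cells (a + 1) w) = word_weight P (2 * (a + 1)) w"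
      using Cons.prems True by (intro Cons.IH) auto
    ultimately show ?thesis using True disj
      by (simp add: sum.union_disjoint algebra_simps)
  next
    case False
    with Cons show ?thesis by simp
  qed
qed simp

lemma card_cells: "real (card (cells a w)) = word_weight of_int (2 * a) w"
  using sum_cells[of a w "\<lambda>_. 1" of_int] by (simp add: increment_def)

lemma downset_cells: "downset (shifted_triangle a (length w)) (cells a w)"
proof (induction w arbitrary: a)
  case (Cons z w)
  have "p \<in> cells a (z # w)"
    if p: "p \<in> shifted_triangle a (length (z # w))" and q: "q \<in> cells a (z # w)" and "p \<le> q" for p q
  proof -
    obtain x y x' y' where pq: "p = (x, y)" "q = (x', y')" by (cases p; cases q)
    then have le: "x \<le> x'" "y \<le> y'" using \<open>p \<le> q\<close> by auto
    have p': "a \<le> x" "x \<le> y" "y \<le> a + int (length w)"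
      using p pq by (auto simp: shifted_triangle_def)
    show ?thesis
    proof (cases z)
      case True
      show ?thesis
      proof (cases "x = a")
        case True
        with p' pq \<open>z\<close> show ?thesis by auto
      next
        case False
        then have "(x', y') \<in> cells (a + 1) w" "p \<in> shifted_triangle (a + 1) (length w)"
          using q pq le p' \<open>z\<close> by (auto simp: shifted_triangle_def)
        then have "p \<in> cells (a + 1) w"
          using Cons.IH[of "a + 1"] \<open>p \<le> q\<close> pq unfolding downset_def by blast
        then show ?thesis using \<open>z\<close> by simp
      qed
    next
      case False
      then have q': "q \<in> cells a w" using q by simp
      then have "p \<in> shifted_triangle a (length w)"
        using cells_subset[of a w] pq le p' by (auto simp: shifted_triangle_def)
      then have "p \<in> cells a w"
        using q' Cons.IH[of a] \<open>p \<le> q\<close> unfolding downset_def by blast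
      then show ?thesis using False by simp
    qed
  qed
  then show ?case using cells_subset[of a "z # w"] unfolding downset_def by blast
qed (simp add: downset_def)

text \<open>The corner \<open>(a, a + int n)\<close> decides the first letter: if it lies in
  \<open>A\<close>, so does the whole first row below it; if not, \<open>A\<close> misses the last
  column above it.\<close>

lemma downset_imp_cells:
  "downset (shifted_triangle a n) A \<Longrightarrow> \<exists>w. length w = n \<and> A = cells a w"
proof (induction n arbitrary: a A)
  case 0
  then have "A = {}" by (auto simp: downset_def shifted_triangle_def)
  then show ?case by simp
next
  case (Suc n)
  then have sub: "A \<subseteq> shifted_triangle a (Suc n)"
    and closed: "\<And>x y. x \<in> shifted_triangle a (Suc n) \<Longrightarrow> y \<in> A \<Longrightarrow> x \<le> y \<Longrightarrow> x \<in> A"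
    by (auto simp: downset_def)
  show ?case
  proof (cases "(a, a + int n) \<in> A")
    case True
    let ?row = "Pair a ` {a..a + int n}"
    have row: "?row \<subseteq> A"
      using closed[OF _ True] by (auto simp: shifted_triangle_def)
    have "downset (shifted_triangle (a + 1) n) (A - ?row)"
      unfolding downset_def
    proof (intro conjI ballI impI)
      show "A - ?row \<subseteq> shifted_triangle (a + 1) n"
      proof
        fix p assume p: "p \<in> A - ?row"
        obtain x y where xy: "p = (x, y)" by (cases p)
        then have "a \<le> x" "x \<le> y" "y \<le> a + int n" "x \<noteq> a"
          using p sub by (auto simp: shifted_triangle_def)
        then show "p \<in> shifted_triangle (a + 1) n" by (simp add: xy shifted_triangle_def)
      qed
      fix x y assume x: "x \<in> shifted_triangle (a + 1) n" and y: "y \<in> A - ?row" and "x \<le> y"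
      then have "x \<in> A" using closed[of x y] by (auto simp: shifted_triangle_def)
      with x show "x \<in> A - ?row" by (auto simp: shifted_triangle_def)
    qed
    then obtain w where w: "length w = n" "A - ?row = cells (a + 1) w" using Suc.IH by blast
    then have "A = cells a (True # w)" using row by auto
    with w(1) show ?thesis by (intro exI[of _ "True # w"]) simp
  next
    case False
    have "(x, y) \<in> shifted_triangle a n" if "(x, y) \<in> A" for x y
    proof (rule ccontr)
      assume "(x, y) \<notin> shifted_triangle a n"
      then have "y = a + int n" "a \<le> x" using sub that by (auto simp: shifted_triangle_def)
      with False that closed[of "(a, a + int n)" "(x, y)"] show False
        by (auto simp: shifted_triangle_def)
    qed
    then have "A \<subseteq> shifted_triangle a n" by auto
    moreover have "shifted_triangle a n \<subseteq> shifted_triangle a (Suc n)"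
      by (auto simp: shifted_triangle_def)
    ultimately have "downset (shifted_triangle a n) A"
      using closed unfolding downset_def by blast
    then obtain w where w: "length w = n" "A = cells a w" using Suc.IH by blast
    then show ?thesis by (intro exI[of _ "False # w"]) simp
  qed
qed

section \<open>From weight functions to potentials\<close>

lemma rank_weight_potential:
  assumes "l \<ge> 1" "rank_increasing (triangle l) wt" "rank_constant (triangle l) wt"
  obtains P where "strictly_convex P"
    "\<And>x y. (x, y) \<in> triangle l \<Longrightarrow> wt (x, y) = increment P (x + y)"
proof -
  let ?m = "2 * l - 2"
  \<comment> \<open>The cell of rank \<open>r\<close> on or next to the diagonal; it lies in the
    triangle for every rank from 0 to \<open>?m\<close>.\<close>
  define cell :: "int \<Rightarrow> int \<times> int" where "cell r = (r div 2, r - r div 2)" for r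
  \<comment> \<open>Outside the occurring ranks the weight continues with slope 1, which keeps
    \<open>W\<close> strictly increasing on all integers.\<close>
  define W where "W r = (if r < 0 then wt (cell 0) + of_int r
    else if r > ?m then wt (cell ?m) + of_int (r - ?m) else wt (cell r))" for r
  have cell: "cell r \<in> triangle l" "rank (cell r) = r" if "0 \<le> r" "r \<le> ?m" for r
    using that by (auto simp: cell_def triangle_def rank_def)
  have mono: "wt (cell r) < wt (cell r')" if "0 \<le> r" "r < r'" "r' \<le> ?m" for r r'
    using assms(2) cell[of r] cell[of r'] that unfolding rank_increasing_def by auto
  have mono': "wt (cell r) \<le> wt (cell r')" if "0 \<le> r" "r \<le> r'" "r' \<le> ?m" for r r'
    using mono[of r r'] that by (cases "r = r'") auto
  have "W r < W r'" if "r < r'" for r r'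
  proof -
    consider "r' < 0" | "r < 0" "0 \<le> r'" "r' \<le> ?m" | "r < 0" "?m < r'" | "0 \<le> r" "r' \<le> ?m"
      | "0 \<le> r" "r \<le> ?m" "?m < r'" | "?m < r" by linarith
    then show ?thesis
    proof cases
      case 1
      with that show ?thesis by (simp add: W_def)
    next
      case 2
      with mono'[of 0 r'] show ?thesis by (simp add: W_def)
    next
      case 3
      with mono'[of 0 ?m] assms(1) show ?thesis by (simp add: W_def)
    next
      case 4
      with mono[of r r'] that show ?thesis by (simp add: W_def)
    next
      case 5
      with mono'[of r ?m] show ?thesis by (simp add: W_def)
    next
      case 6
      with that assms(1) show ?thesis by (simp add: W_def)
    qed
  qed
  then have "strict_mono W" by (auto simp: strict_mono_def)
  moreover obtain P where P: "W = increment P" using antiderivative_exists by blast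
  moreover have "wt (x, y) = W (x + y)" if xy: "(x, y) \<in> triangle l" for x y
  proof -
    have r: "0 \<le> x + y" "x + y \<le> ?m" using xy by (auto simp: triangle_def)
    have "rank (x, y) = rank (cell (x + y))" using cell(2)[OF r] by (simp add: rank_def)
    then have "wt (x, y) = wt (cell (x + y))"
      using assms(3) xy cell(1)[OF r] unfolding rank_constant_def by blast
    with r show ?thesis by (simp add: W_def)
  qed
  ultimately show ?thesis using that[of P] unfolding strictly_convex_def P by blast
qed

lemma optimal_downset_imp_optimal_word:
  assumes "l \<ge> 1" "rank_increasing (triangle l) wt" "rank_constant (triangle l) wt"
    and "optimal_downset (triangle l) wt A"
  obtains P w where "strictly_convex P" "optimal_word P 0 w" "int (length w) = l" "A = cells 0 w"
proof -
  obtain P where P: "strictly_convex P"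
    "\<And>x y. (x, y) \<in> triangle l \<Longrightarrow> wt (x, y) = increment P (x + y)"
    using rank_weight_potential[OF assms(1-3)] by blast
  have tri: "triangle l = shifted_triangle 0 (nat l)" using assms(1) by (simp add: triangle_eq_shifted)
  obtain w where w: "length w = nat l" "A = cells 0 w"
    using assms(4) downset_imp_cells unfolding optimal_downset_def tri by blast
  have weight: "sum wt (cells 0 v) = word_weight P 0 v" if "length v = nat l" for v
    using sum_cells[of 0 v wt P] P(2) cells_subset[of 0 v] that unfolding tri by auto
  have "optimal_word P 0 w"
    unfolding optimal_word_def
  proof (intro allI impI)
    fix w' assume w': "length w' = length w \<and> word_weight of_int 0 w' = word_weight of_int 0 w"
    then have "card (cells 0 w') = card A"
      using card_cells[of 0 w'] card_cells[of 0 w] w by simp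
    moreover have "downset (triangle l) (cells 0 w')"
      using downset_cells[of 0 w'] w w' tri by simp
    ultimately have "sum wt (cells 0 w') \<le> sum wt A"
      using assms(4) unfolding optimal_downset_def by blast
    with weight w w' show "word_weight P 0 w' \<le> word_weight P 0 w" by simp
  qed
  with P(1) w assms(1) show ?thesis using that[of P w] by simp
qed

subsection \<open>Initial segments and symmetrization\<close>

text \<open>The predecessors of an element of \<open>I\<close> form a proper subset of
  \<open>I\<close>; by totality, an element outside has all of \<open>I\<close> before it.\<close>

lemma initial_segment_eqI:
  assumes "finite R" "I \<subseteq> R"
    and irrefl: "\<And>x. \<not> lt x x"
    and total: "\<And>x y. x \<noteq> y \<Longrightarrow> lt x y \<or> lt y x"
    and closed: "\<And>x y. x \<in> I \<Longrightarrow> y \<in> R \<Longrightarrow> lt y x \<Longrightarrow> y \<in> I"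
  shows "initial_segment lt R (card I) = I"
proof -
  have fin: "finite I" using assms(1,2) finite_subset by blast
  have "card {y \<in> R. lt y x} < card I \<longleftrightarrow> x \<in> I" if "x \<in> R" for x
  proof
    assume x: "x \<in> I"
    then have "{y \<in> R. lt y x} \<subset> I" using closed irrefl by blast
    then show "card {y \<in> R. lt y x} < card I" using fin psubset_card_mono by blast
  next
    assume less: "card {y \<in> R. lt y x} < card I"
    show "x \<in> I"
    proof (rule ccontr)
      assume "x \<notin> I"
      have "y \<in> R \<and> lt y x" if "y \<in> I" for y
        using total[of x y] closed[of y x] that \<open>x \<notin> I\<close> \<open>x \<in> R\<close> assms(2) by auto
      then have "I \<subseteq> {y \<in> R. lt y x}" by blast
      then have "card I \<le> card {y \<in> R. lt y x}" using assms(1) by (intro card_mono) auto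
      with less show False by simp
    qed
  qed
  then show ?thesis using assms(2) unfolding initial_segment_def by blast
qed

lemma finite_triangle: "finite (triangle l)"
  by (rule finite_subset[of _ "{0..l} \<times> {0..l}"]) (auto simp: triangle_def)

text \<open>The word describes \<open>a\<close> full rows and, for \<open>e = 1\<close>, a further
  row of \<open>c + 1\<close> cells.\<close>

lemma cells_L_initial_segment:
  assumes "e \<le> 1" and w: "w = ups a @ downs b @ ups e @ downs c" and "int (length w) = l"
  shows "initial_segment less_L (triangle l) (card (cells 0 w)) = cells 0 w"
proof (rule initial_segment_eqI[OF finite_triangle])
  show "cells 0 w \<subseteq> triangle l"
    using cells_subset[of 0 w] assms(3) by (auto simp: triangle_def shifted_triangle_def)
  fix p q assume p: "p \<in> cells 0 w" and q: "q \<in> triangle l" and less: "less_L q p"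
  obtain x y x' y' where pq: "p = (x, y)" "q = (x', y')" by (cases p; cases q)
  have "e = 0 \<or> e = 1" using assms(1) by linarith
  then show "q \<in> cells 0 w"
    using p q less assms(3) unfolding pq w
    by (elim disjE)
      (simp_all add: less_L_def triangle_def cells_ups cells_all_ups image_iff, linarith+)
qed (auto simp: less_L_def)

text \<open>The word describes \<open>b + c\<close> full columns and, for \<open>e = 1\<close>, the
  first \<open>b\<close> cells of the next one.\<close>

lemma cells_C_initial_segment:
  assumes "e \<le> 1" and w: "w = downs a @ ups b @ downs e @ ups c" and "int (length w) = l"
  shows "initial_segment less_C (triangle l) (card (cells 0 w)) = cells 0 w"
proof (rule initial_segment_eqI[OF finite_triangle])
  show "cells 0 w \<subseteq> triangle l"
    using cells_subset[of 0 w] assms(3) by (auto simp: triangle_def shifted_triangle_def)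
  fix p q assume p: "p \<in> cells 0 w" and q: "q \<in> triangle l" and less: "less_C q p"
  obtain x y x' y' where pq: "p = (x, y)" "q = (x', y')" by (cases p; cases q)
  have "e = 0 \<or> e = 1" using assms(1) by linarith
  then show "q \<in> cells 0 w"
    using p q less assms(3) unfolding pq w
    by (elim disjE)
      (simp_all add: less_C_def triangle_def cells_ups cells_all_ups image_iff, linarith+)
qed (auto simp: less_C_def)

lemma card_cells_eqI:
  assumes "\<And>Q. word_weight (increment Q) 0 v = word_weight (increment Q) 0 w"
  shows "card (cells 0 v) = card (cells 0 w)"
proof -
  obtain Q where "of_int = increment Q" using antiderivative_exists by blast
  with assms[of Q] card_cells[of 0 v] card_cells[of 0 w] show ?thesis by simp
qed

text \<open>Since \<open>reflect\<close> is an involution of the square swapping local coordinates,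
  membership depends only on \<open>p\<close> and its mirror image. Cells move to the side with
  larger coordinate \<open>c1\<close>. Equalities with \<open>Sym\<close> thus become linear
  arithmetic.\<close>

lemma mem_Sym_iff:
  assumes sq: "square s t" and c: "c1 \<in> {1, 2}" "c2 \<in> {1, 2}" "c1 \<noteq> c2"
  shows "p \<in> Sym s t I c1 c2 \<longleftrightarrow>
    p \<in> I \<and> (p \<notin> packed s t \<or> reflect s p \<in> I \<or> local_coord s c2 p \<le> local_coord s c1 p) \<or>
    p \<in> packed s t \<and> reflect s p \<in> I \<and> local_coord s c2 p < local_coord s c1 p"
proof -
  have invol: "reflect s (reflect s f) = f" for f by (simp add: reflect_def)
  have inQ: "reflect s f \<in> packed s t \<longleftrightarrow> f \<in> packed s t" for f
    using sq by (auto simp: reflect_def packed_def square_def)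
  have swap: "local_coord s c1 (reflect s f) = local_coord s c2 f"
    "local_coord s c2 (reflect s f) = local_coord s c1 f" for f
    using c by (auto simp: reflect_def local_coord_def)
  have "p \<in> orient s c1 c2 ` (I \<inter> packed s t) \<longleftrightarrow>
      p \<in> I \<inter> packed s t \<and> local_coord s c2 p \<le> local_coord s c1 p \<or>
      reflect s p \<in> I \<inter> packed s t \<and> local_coord s c2 p < local_coord s c1 p" (is "?l \<longleftrightarrow> ?r")
  proof
    assume ?l
    then obtain f where "f \<in> I \<inter> packed s t" "p = orient s c1 c2 f" by blast
    then show ?r by (auto simp: orient_def invol swap split: if_splits)
  next
    assume ?r
    then show ?l
    proof (elim disjE conjE)
      assume "p \<in> I \<inter> packed s t" "local_coord s c2 p \<le> local_coord s c1 p"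
      then show ?l by (intro image_eqI[of _ _ p]) (auto simp: orient_def)
    next
      assume "reflect s p \<in> I \<inter> packed s t" "local_coord s c2 p < local_coord s c1 p"
      then show ?l by (intro image_eqI[of _ _ "reflect s p"]) (auto simp: orient_def invol swap)
    qed
  qed
  with c(3) inQ[of p] show ?thesis unfolding Sym_def by auto
qed

section \<open>Exceptional shapes as symmetrized segments\<close>

definition Sym_of_segment :: "int \<Rightarrow> (int \<times> int) set \<Rightarrow> bool" where
  "Sym_of_segment l A \<longleftrightarrow> (\<exists>D\<in>{less_L, less_C}. \<exists>s t. \<exists>c1\<in>{1, 2}. \<exists>c2\<in>{1, 2}.
     packed s t \<subseteq> triangle l \<and> (c1 = c2 \<or> square s t) \<and>
     A = Sym s t (initial_segment D (triangle l) (card A)) c1 c2)"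

text \<open>Here \<open>v\<close> is the word of the segment; equal weights for all potentials force
  equal cell counts, so the segment has the required size.\<close>

lemma Sym_of_segmentI:
  assumes "D \<in> {less_L, less_C}" "initial_segment D (triangle l) (card (cells 0 v)) = cells 0 v"
    and "\<And>Q. word_weight (increment Q) 0 v = word_weight (increment Q) 0 w"
    and "packed s t \<subseteq> triangle l" "square s t" "c1 \<in> {1, 2}" "c2 \<in> {1, 2}" "c1 \<noteq> c2"
    and "\<And>x y. (x, y) \<in> cells 0 w \<longleftrightarrow> (x, y) \<in> Sym s t (cells 0 v) c1 c2"
  shows "Sym_of_segment l (cells 0 w)"
proof -
  have "card (cells 0 v) = card (cells 0 w)" using card_cells_eqI assms(3) by blast
  moreover have "cells 0 w = Sym s t (cells 0 v) c1 c2" using assms(9) by auto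
  ultimately have "cells 0 w = Sym s t (initial_segment D (triangle l) (card (cells 0 w))) c1 c2"
    using assms(2) by metis
  with assms(1,4-7) show ?thesis unfolding Sym_of_segment_def by blast
qed

lemma coordinates: "(1::nat) \<in> {1, 2}" "(2::nat) \<in> {1, 2}" "(1::nat) \<noteq> 2" "(2::nat) \<noteq> 1"
  by auto

lemmas box_defs = packed_def triangle_def square_def reflect_def local_coord_def

lemma L_corner_Sym:
  assumes "1 \<le> b" "w = ups a @ downs b @ [True, True]" "int (length w) = l"
  shows "Sym_of_segment l (cells 0 w)"
proof -
  obtain b' where b: "b = Suc b'" using assms(1) by (cases b) auto
  \<comment> \<open>The segment ends with a row of three cells; the square reflects its last cell
    \<open>(a, a + 2)\<close> to \<open>(a + 1, a + 1)\<close>.\<close>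
  let ?v = "ups a @ downs b' @ True # downs 2"
  let ?s = "(int a, int a + 1)" and ?t = "(int a + 1, int a + 2)"
  show ?thesis
  proof (rule Sym_of_segmentI[of less_L l ?v _ ?s ?t 1 2])
    show "initial_segment less_L (triangle l) (card (cells 0 ?v)) = cells 0 ?v"
      using assms b by (intro cells_L_initial_segment[of 1 _ a b' 2]) auto
    show "word_weight (increment Q) 0 ?v = word_weight (increment Q) 0 w" for Q
      unfolding assms b
      by (simp add: word_weight_eq_height_sum increment_def algebra_simps numeral_2_eq_2 del: replicate_Suc)
    show "packed ?s ?t \<subseteq> triangle l" using assms b by (auto simp: box_defs)
    have sq: "square ?s ?t" by (simp add: box_defs)
    then show "square ?s ?t" .
    show "(x, y) \<in> cells 0 w \<longleftrightarrow> (x, y) \<in> Sym ?s ?t (cells 0 ?v) 1 2" for x y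
      unfolding mem_Sym_iff[OF sq coordinates(1,2,3)]
      unfolding assms b
      by (simp add: cells_ups box_defs image_iff) linarith
  qed auto
qed

lemma L_square_Sym:
  assumes "1 \<le> b" "b < c" "w = ups a @ False # ups b @ downs c" "int (length w) = l"
  shows "Sym_of_segment l (cells 0 w)"
proof -
  obtain b' where b: "b = Suc b'" using assms(1) by (cases b) auto
  obtain d where c: "c = Suc (Suc (b' + d))"
    using assms(2) b by (metis add_Suc less_imp_Suc_add)
  \<comment> \<open>Within this \<open>b\<close> by \<open>b\<close> square the segment lacks
    exactly the last row; reflection turns the gap into the last column.\<close>
  let ?v = "ups (a + b') @ downs b @ True # downs (d + 2)"
  let ?s = "(int a, int a + int c + 1)" and ?t = "(int a + int b', l - 1)"
  show ?thesis
  proof (rule Sym_of_segmentI[of less_L l ?v _ ?s ?t 1 2])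
    show "initial_segment less_L (triangle l) (card (cells 0 ?v)) = cells 0 ?v"
      using assms b c by (intro cells_L_initial_segment[of 1 _ "a + b'" b "d + 2"]) auto
    show "word_weight (increment Q) 0 ?v = word_weight (increment Q) 0 w" for Q
      unfolding assms b c
      by (simp add: word_weight_eq_height_sum increment_def algebra_simps del: replicate_Suc)
    show "packed ?s ?t \<subseteq> triangle l" using assms b c by (auto simp: box_defs)
    have sq: "square ?s ?t" using assms b c by (simp add: box_defs)
    then show "square ?s ?t" .
    have l: "l = int a + int b' + int c + 2" using assms b by simp
    show "(x, y) \<in> cells 0 w \<longleftrightarrow> (x, y) \<in> Sym ?s ?t (cells 0 ?v) 1 2" for x y
      unfolding mem_Sym_iff[OF sq coordinates(1,2,3)]
      unfolding assms(3) b c l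
      by (simp add: cells_ups box_defs image_iff del: replicate_Suc) linarith
  qed auto
qed

lemma C_corner_Sym:
  assumes "1 \<le> b" "w = downs a @ ups b @ [False, False]" "int (length w) = l"
  shows "Sym_of_segment l (cells 0 w)"
proof -
  obtain b' where b: "b = Suc b'" using assms(1) by (cases b) auto
  \<comment> \<open>The segment contains \<open>(b, b)\<close> but not \<open>(b', b + 1)\<close>;
    the square exchanges these two.\<close>
  let ?v = "downs a @ ups b' @ False # ups 2"
  let ?s = "(int b', int b)" and ?t = "(int b, int b + 1)"
  show ?thesis
  proof (rule Sym_of_segmentI[of less_C l ?v _ ?s ?t 2 1])
    show "initial_segment less_C (triangle l) (card (cells 0 ?v)) = cells 0 ?v"
      using assms b by (intro cells_C_initial_segment[of 1 _ a b' 2]) auto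
    show "word_weight (increment Q) 0 ?v = word_weight (increment Q) 0 w" for Q
      unfolding assms b
      by (simp add: word_weight_eq_height_sum increment_def algebra_simps numeral_2_eq_2 del: replicate_Suc)
    show "packed ?s ?t \<subseteq> triangle l" using assms b by (auto simp: box_defs)
    have sq: "square ?s ?t" using b by (simp add: box_defs)
    then show "square ?s ?t" .
    show "(x, y) \<in> cells 0 w \<longleftrightarrow> (x, y) \<in> Sym ?s ?t (cells 0 ?v) 2 1" for x y
      unfolding mem_Sym_iff[OF sq coordinates(2,1,4)]
      unfolding assms b
      by (simp add: cells_ups cells_all_ups box_defs del: replicate_Suc) linarith
  qed auto
qed

lemma C_square_Sym:
  assumes "1 \<le> b" "b < c" "w = downs a @ True # downs b @ ups c" "int (length w) = l"
  shows "Sym_of_segment l (cells 0 w)"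
proof -
  obtain b' where b: "b = Suc b'" using assms(1) by (cases b) auto
  obtain d where c: "c = Suc (Suc (b' + d))"
    using assms(2) b by (metis add_Suc less_imp_Suc_add)
  \<comment> \<open>Within the square the segment has only the first column, \<open>b\<close> cells;
    reflection lays them along row 0.\<close>
  let ?v = "downs (a + b') @ ups b @ False # ups (d + 2)"
  let ?s = "(0, int c + 1)" and ?t = "(int b', int c + int b)"
  show ?thesis
  proof (rule Sym_of_segmentI[of less_C l ?v _ ?s ?t 2 1])
    show "initial_segment less_C (triangle l) (card (cells 0 ?v)) = cells 0 ?v"
      using assms b c by (intro cells_C_initial_segment[of 1 _ "a + b'" b "d + 2"]) auto
    show "word_weight (increment Q) 0 ?v = word_weight (increment Q) 0 w" for Q
      unfolding assms b c
      by (simp add: word_weight_eq_height_sum increment_def algebra_simps del: replicate_Suc)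
    show "packed ?s ?t \<subseteq> triangle l" using assms b c by (auto simp: box_defs)
    have sq: "square ?s ?t" using b by (simp add: box_defs)
    then show "square ?s ?t" .
    show "(x, y) \<in> cells 0 w \<longleftrightarrow> (x, y) \<in> Sym ?s ?t (cells 0 ?v) 2 1" for x y
      unfolding mem_Sym_iff[OF sq coordinates(2,1,4)]
      unfolding assms(3) b c
      by (simp add: cells_ups cells_all_ups box_defs image_iff del: replicate_Suc) linarith
  qed auto
qed

theorem theorem5p5:
  fixes l :: int and wt :: "int \<times> int \<Rightarrow> real" and A :: "(int \<times> int) set"
  assumes "l \<ge> 1"
    and "rank_increasing (triangle l) wt"
    and "rank_constant (triangle l) wt"
    and "optimal_downset (triangle l) wt A"
  shows "(A = initial_segment less_L (triangle l) (card A) \<or>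
          A = initial_segment less_C (triangle l) (card A)) \<or>
         (\<exists>D\<in>{less_L, less_C}. \<exists>s t. \<exists>c1\<in>{1, 2}. \<exists>c2\<in>{1, 2}.
            packed s t \<subseteq> triangle l \<and> (c1 = c2 \<or> square s t) \<and>
            A = Sym s t (initial_segment D (triangle l) (card A)) c1 c2)"
proof -
  obtain P w where P: "strictly_convex P" "optimal_word P 0 w"
    and w: "int (length w) = l" "A = cells 0 w"
    using optimal_downset_imp_optimal_word[OF assms] .
  from optimal_word_classification[OF P]
  have "A = initial_segment less_L (triangle l) (card A) \<or>
    A = initial_segment less_C (triangle l) (card A) \<or> Sym_of_segment l A"
  proof
    assume "L_family w"
    then show ?thesis
      unfolding L_family_def
      using cells_L_initial_segment[OF _ _ w(1)] L_corner_Sym[OF _ _ w(1)] L_square_Sym[OF _ _ _ w(1)] w(2)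
      by metis
  next
    assume "C_family w"
    then show ?thesis
      by (cases rule: C_family_cases)
        (use cells_C_initial_segment[OF _ _ w(1)] C_corner_Sym[OF _ _ w(1)] C_square_Sym[OF _ _ _ w(1)] w(2)
          in \<open>metis+\<close>)
  qed
  then show ?thesis unfolding Sym_of_segment_def by blast
qed

end
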